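(* Let $n$ be a positive integer and let $R$ be a unital ring with $n\in U(R)$. Let $\omega\in U(Z(R))$ satisfy $\omega^n=1$ and $\omega^i-\omega^j\in U(R)$ for all $i\neq j$, $0\leq i,j\leq n-1$. Suppose there exist $a,b\in R$ such that $u:=[a,b]$ satisfies $u^n=1$. Then there exist $e_0,e_1,\dots,e_{n-1}\in R$ such that: (1) $e_k^2=e_k$ for all $k$, and $e_ke_\ell=0$ if $k\neq\ell$; (2) $\sum_{k=0}^{n-1}e_k=1$; (3) $u=\sum_{k=0}^{n-1}\omega^ke_k$.
   Context: Rings are associative with identity $1$ and not necessarily commutative. $U(R)$ is the group of units of $R$, $Z(R)$ its center, and $[a,b]:=ab-ba$. "$n\in U(R)$" means that $n\cdot 1_R$ is a unit. *)

theory Defs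
  imports "HOL-Algebra.Ring"
begin

definition ring_center :: "('a, 'm) ring_scheme \<Rightarrow> 'a set" where
  "ring_center R = {z \<in> carrier R. \<forall>x \<in> carrier R. z \<otimes>\<^bsub>R\<^esub> x = x \<otimes>\<^bsub>R\<^esub> z}"

definition center_ring :: "('a, 'm) ring_scheme \<Rightarrow> ('a, 'm) ring_scheme" where
  "center_ring R = R\<lparr>carrier := ring_center R\<rparr>"

definition ring_commutator :: "('a, 'm) ring_scheme \<Rightarrow> 'a \<Rightarrow> 'a \<Rightarrow> 'a" where
  "ring_commutator R a b = a \<otimes>\<^bsub>R\<^esub> b \<ominus>\<^bsub>R\<^esub> b \<otimes>\<^bsub>R\<^esub> a"

end

theory Submission
  imports Defs
begin

text \<open>
  Since \<open>\<omega>\<close> is central, \<open>v = \<omega>^(n-1)\<close> is a central inverse of \<open>\<omega>\<close>, and \<open>e k\<close> is the discrete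
  Fourier average of the powers of \<open>v^k u\<close>, whose \<open>n\<close>-th power is \<open>1\<close>. A sum over all powers of such
  an element is fixed by multiplication with it, so \<open>u (e k) = \<omega>^k (e k)\<close>. Invertibility of the
  differences \<open>\<omega>^i - \<omega>^j\<close> makes eigenelements for different \<open>k\<close> orthogonal and kills the sums
  \<open>\<Sum>\<^sub>k v^(j k)\<close> with \<open>0 < j < n\<close>, so that the \<open>e k\<close> sum to \<open>1\<close>; idempotency follows by multiplying
  that sum with \<open>e k\<close>.
\<close>

lemma (in abelian_monoid) finsum_swap:
  assumes "finite A" "finite B" "\<And>i j. i \<in> A \<Longrightarrow> j \<in> B \<Longrightarrow> f i j \<in> carrier G"
  shows "(\<Oplus>i\<in>A. \<Oplus>j\<in>B. f i j) = (\<Oplus>j\<in>B. \<Oplus>i\<in>A. f i j)"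
  using assms(1,3)
proof (induction A rule: finite_induct)
  case empty
  then show ?case by (simp add: finsum_zero)
next
  case (insert x F)
  have "(\<Oplus>i\<in>insert x F. \<Oplus>j\<in>B. f i j) = (\<Oplus>j\<in>B. f x j) \<oplus> (\<Oplus>j\<in>B. \<Oplus>i\<in>F. f i j)"
    using insert by (subst finsum_insert) (auto intro!: finsum_closed)
  also have "\<dots> = (\<Oplus>j\<in>B. f x j \<oplus> (\<Oplus>i\<in>F. f i j))"
    using insert.prems by (subst finsum_addf) (auto intro!: finsum_closed)
  also have "\<dots> = (\<Oplus>j\<in>B. \<Oplus>i\<in>insert x F. f i j)"
    using insert by (intro finsum_cong' refl) (auto intro!: finsum_closed simp: finsum_insert)
  finally show ?case .
qed

context ring
begin

text \<open>Both sides are the sum of \<open>x [^] j\<close> over all \<open>j\<close> up to and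
  including \<open>n\<close>. Moving \<open>\<one>\<close> to the left keeps subtraction out of the
  induction.\<close>

lemma geometric_finsum:
  assumes x: "x \<in> carrier R"
  shows "x \<otimes> (\<Oplus>j\<in>{..<n}. x [^] j) \<oplus> \<one> = (\<Oplus>j\<in>{..<n}. x [^] (j::nat)) \<oplus> x [^] n"
proof (induction n)
  case 0
  then show ?case using x by (simp add: finsum_empty)
next
  case (Suc n)
  let ?S = "\<Oplus>j\<in>{..<n}. x [^] j"
  have S: "?S \<in> carrier R" using x by (auto intro!: finsum_closed)
  have expand: "(\<Oplus>j\<in>{..<Suc n}. x [^] j) = x [^] n \<oplus> ?S"
    using x by (simp add: lessThan_Suc finsum_insert Pi_def)
  have "x \<otimes> (x [^] n \<oplus> ?S) \<oplus> \<one> = x [^] Suc n \<oplus> (x \<otimes> ?S \<oplus> \<one>)"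
    using x S nat_pow_Suc2[OF x] by (simp add: r_distr a_assoc del: nat_pow_Suc)
  also have "\<dots> = x [^] n \<oplus> ?S \<oplus> x [^] Suc n"
    using x S Suc.IH by (simp add: a_ac)
  finally show ?case by (simp only: expand)
qed

lemma finsum_root_of_unity_fixed:
  assumes x: "x \<in> carrier R" and "x [^] n = \<one>"
  shows "x \<otimes> (\<Oplus>j\<in>{..<n}. x [^] j) = (\<Oplus>j\<in>{..<n}. x [^] (j::nat))"
  using geometric_finsum[OF x, of n] assms
  by (simp add: finsum_closed)

lemma Units_mult_eq_zeroD:
  assumes "c \<in> Units R" "x \<in> carrier R" "c \<otimes> x = \<zero>"
  shows "x = \<zero>"
  by (metis assms Units_closed Units_l_cancel r_null zero_closed)

text \<open>The difference \<open>c \<ominus> d\<close> annihilates \<open>x\<close>, and a unit can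
  be cancelled. With powers of \<open>\<omega>\<close> as \<open>c\<close> and \<open>d\<close>,
  this says that no nonzero element has two different eigenvalues.\<close>

lemma eq_mult_eq_zero:
  assumes "c \<ominus> d \<in> Units R" "c \<in> carrier R" "d \<in> carrier R" "x \<in> carrier R"
    and "c \<otimes> x = d \<otimes> x"
  shows "x = \<zero>"
proof -
  have "(c \<ominus> d) \<otimes> x = c \<otimes> x \<oplus> \<ominus> (d \<otimes> x)"
    using assms by (simp add: minus_eq l_distr l_minus)
  also have "\<dots> = \<zero>"
    using assms by (simp add: r_neg)
  finally show ?thesis using assms by (blast intro: Units_mult_eq_zeroD)
qed

lemma commute_finsum:
  assumes "finite A" "x \<in> carrier R" "\<And>i. i \<in> A \<Longrightarrow> f i \<in> carrier R"
    and "\<And>i. i \<in> A \<Longrightarrow> x \<otimes> f i = f i \<otimes> x"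
  shows "x \<otimes> (\<Oplus>i\<in>A. f i) = (\<Oplus>i\<in>A. f i) \<otimes> x"
proof -
  have "x \<otimes> (\<Oplus>i\<in>A. f i) = (\<Oplus>i\<in>A. x \<otimes> f i)"
    using assms by (intro finsum_rdistr) auto
  also have "\<dots> = (\<Oplus>i\<in>A. f i \<otimes> x)"
    using assms by (intro finsum_cong') auto
  also have "\<dots> = (\<Oplus>i\<in>A. f i) \<otimes> x"
    using assms by (intro finsum_ldistr[symmetric]) auto
  finally show ?thesis .
qed

lemma commute_mult:
  assumes "x \<in> carrier R" "y \<in> carrier R" "z \<in> carrier R"
    and "x \<otimes> y = y \<otimes> x" "x \<otimes> z = z \<otimes> x"
  shows "x \<otimes> (y \<otimes> z) = y \<otimes> z \<otimes> x"
  using assms by (metis m_assoc)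

lemma commute_nat_pow:
  assumes "x \<in> carrier R" "y \<in> carrier R" "x \<otimes> y = y \<otimes> x"
  shows "x \<otimes> y [^] (k::nat) = y [^] k \<otimes> x"
  using assms by (induction k) (auto intro: commute_mult)

text \<open>Insert \<open>inv c \<otimes> c\<close> on the left of \<open>x \<otimes> inv c\<close>,
  then move \<open>c\<close> past \<open>x\<close>. This carries centrality from
  \<open>[n] \<cdot> \<one>\<close> over to its inverse.\<close>

lemma commute_inv_unit:
  assumes "c \<in> Units R" "x \<in> carrier R" "x \<otimes> c = c \<otimes> x"
  shows "x \<otimes> inv c = inv c \<otimes> x"
proof -
  have c: "c \<in> carrier R" "inv c \<in> carrier R"
    using assms by auto
  have "x \<otimes> inv c = inv c \<otimes> (c \<otimes> x) \<otimes> inv c"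
    using assms c by (simp flip: m_assoc)
  also have "\<dots> = inv c \<otimes> x \<otimes> (c \<otimes> inv c)"
    using assms c by (metis m_assoc m_closed)
  finally show ?thesis
    using assms c by simp
qed

lemma root_of_unity_decomposition:
  fixes n :: nat
  assumes n: "n > 0" "[n] \<cdot> \<one> \<in> Units R"
    and w: "w \<in> carrier R" "w [^] n = \<one>"
    and central: "\<And>x. x \<in> carrier R \<Longrightarrow> w \<otimes> x = x \<otimes> w"
    and diff: "\<And>i j :: nat. i < n \<Longrightarrow> j < n \<Longrightarrow> i \<noteq> j \<Longrightarrow> w [^] i \<ominus> w [^] j \<in> Units R"
    and u: "u \<in> carrier R" "u [^] n = \<one>"
  obtains e :: "nat \<Rightarrow> 'a" where
    "\<And>k. e k \<in> carrier R"
    "\<And>k. k < n \<Longrightarrow> e k \<otimes> e k = e k"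
    "\<And>k l. k < n \<Longrightarrow> l < n \<Longrightarrow> k \<noteq> l \<Longrightarrow> e k \<otimes> e l = \<zero>"
    "(\<Oplus>k\<in>{..<n}. e k) = \<one>"
    "u = (\<Oplus>k\<in>{..<n}. w [^] k \<otimes> e k)"
proof -
  define v where "v = w [^] (n - 1)"
  \<comment> \<open>The averaging factor \<open>1/n\<close>, which normalises the \<open>e k\<close>
    so that their sum is \<open>\<one>\<close>.\<close>
  define N where "N = inv ([n] \<cdot> \<one>)"
  define x where "x k = v [^] k \<otimes> u" for k :: nat
  define e where "e k = N \<otimes> (\<Oplus>j\<in>{..<n}. x k [^] j)" for k :: nat
  have v: "v \<in> carrier R" using w by (simp add: v_def)
  have N: "N \<in> carrier R" using n by (simp add: N_def)
  have x: "x k \<in> carrier R" for k using u v by (simp add: x_def)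
  have S: "(\<Oplus>j\<in>{..<n}. x k [^] j) \<in> carrier R" for k
    using x by (auto intro!: finsum_closed)
  have e: "e k \<in> carrier R" for k using S N by (simp add: e_def)
  have w_pow_central: "w [^] (k::nat) \<otimes> y = y \<otimes> w [^] k" if "y \<in> carrier R" for k y
    using commute_nat_pow[OF that w(1)] central that by simp
  have v_pow_central: "v [^] (k::nat) \<otimes> y = y \<otimes> v [^] k" if "y \<in> carrier R" for k y
    using w_pow_central[OF that] w by (simp add: v_def nat_pow_pow)
  have N_central: "N \<otimes> y = y \<otimes> N" if "y \<in> carrier R" for y
    using commute_inv_unit[OF n(2) that] that
    by (simp add: N_def add_pow_ldistr add_pow_rdistr)
  \<comment> \<open>Positivity of \<open>n\<close> makes \<open>Suc (n - 1)\<close> equal to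
    \<open>n\<close>, so the product is \<open>w [^] n\<close>.\<close>
  have wv: "w \<otimes> v = \<one>"
    using n w nat_pow_Suc2[of w "n - 1"] by (simp add: v_def del: nat_pow_Suc)
  have wv_pow: "w [^] (k::nat) \<otimes> v [^] k = \<one>" for k
    using pow_mult_distrib[of w v k] central w v wv by simp
  have v_pow_n: "v [^] n = \<one>"
    using wv_pow[of n] w v by simp
  \<comment> \<open>Centrality of the powers of \<open>v\<close> separates the two factors. For
    \<open>j = n\<close> both become \<open>\<one>\<close>, so \<open>x k\<close> is an
    \<open>n\<close>-th root of unity.\<close>
  have x_pow: "x k [^] (j::nat) = v [^] (k * j) \<otimes> u [^] j" for k j
    using pow_mult_distrib[of "v [^] k" u j] v_pow_central u v
    by (simp add: x_def nat_pow_pow)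
  have pow_n_mult: "v [^] (k * n) = \<one>" for k
    using v v_pow_n by (metis mult.commute nat_pow_one nat_pow_pow)
  have x_fix: "x k \<otimes> e k = e k" for k
  proof -
    have "x k \<otimes> e k = N \<otimes> (x k \<otimes> (\<Oplus>j\<in>{..<n}. x k [^] j))"
      using N S x N_central[OF x] unfolding e_def by (metis m_assoc)
    also have "\<dots> = e k"
      using finsum_root_of_unity_fixed[OF x] x_pow u pow_n_mult by (simp add: e_def)
    finally show ?thesis .
  qed
  have eigen: "u \<otimes> e k = w [^] k \<otimes> e k" for k
  proof -
    \<comment> \<open>Multiplying the fixed-point equation by \<open>w [^] k\<close> cancels the
      twist \<open>v [^] k\<close> inside \<open>x k\<close>.\<close>
    have "w [^] k \<otimes> e k = w [^] k \<otimes> (v [^] k \<otimes> u \<otimes> e k)"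
      using x_fix[of k] by (simp add: x_def)
    also have "\<dots> = (w [^] k \<otimes> v [^] k) \<otimes> (u \<otimes> e k)"
      using w v u e by (simp add: m_assoc)
    finally show ?thesis using wv_pow u e by simp
  qed
  have u_comm: "u \<otimes> e k = e k \<otimes> u" for k
  proof -
    have "u \<otimes> x k = x k \<otimes> u"
      unfolding x_def using u v v_pow_central by (intro commute_mult) auto
    then show ?thesis unfolding e_def
      using N S u x N_central by (intro commute_mult commute_finsum commute_nat_pow) auto
  qed
  have orth: "e k \<otimes> e l = \<zero>" if "k < n" "l < n" "k \<noteq> l" for k l
  proof (rule eq_mult_eq_zero[OF diff[OF that]])
    \<comment> \<open>The product \<open>e k \<otimes> u \<otimes> e l\<close> is evaluated twice:
      \<open>u\<close> acts on \<open>e k\<close> as \<open>w [^] k\<close>, thanks to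
      \<open>u_comm\<close>, and on \<open>e l\<close> as \<open>w [^] l\<close>.\<close>
    have "w [^] k \<otimes> (e k \<otimes> e l) = (e k \<otimes> u) \<otimes> e l"
      using eigen[of k] u_comm[of k] w u e by (simp flip: m_assoc)
    also have "\<dots> = e k \<otimes> (w [^] l \<otimes> e l)"
      using eigen[of l] w u e by (simp add: m_assoc)
    also have "\<dots> = w [^] l \<otimes> (e k \<otimes> e l)"
      using w_pow_central[OF e, of l k] w e by (metis m_assoc nat_pow_closed)
    finally show "w [^] k \<otimes> (e k \<otimes> e l) = w [^] l \<otimes> (e k \<otimes> e l)" .
  qed (use w e in auto)
  have v_sum: "(\<Oplus>k\<in>{..<n}. v [^] (k * j)) = \<zero>" if "0 < j" "j < n" for j
  proof -
    let ?T = "\<Oplus>k\<in>{..<n}. (v [^] j) [^] k"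
    have T: "?T \<in> carrier R" using v by (auto intro!: finsum_closed)
    have "v [^] j \<otimes> ?T = ?T"
      using v pow_n_mult by (intro finsum_root_of_unity_fixed) (auto simp: nat_pow_pow)
    \<comment> \<open>Since \<open>v [^] j\<close> fixes \<open>?T\<close>, so does its inverse
      \<open>w [^] j\<close>. Hence \<open>w [^] j\<close> and \<open>w [^] 0\<close> act alike on
      \<open>?T\<close>, while their difference is a unit.\<close>
    then have "w [^] j \<otimes> ?T = (w [^] j \<otimes> v [^] j) \<otimes> ?T"
      using w v T by (simp add: m_assoc)
    then have "w [^] j \<otimes> ?T = w [^] (0::nat) \<otimes> ?T"
      using wv_pow T by simp
    then have "?T = \<zero>"
      using diff[of j 0] that w T by (intro eq_mult_eq_zero[of "w [^] j" "w [^] (0::nat)"]) auto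
    then show ?thesis using v by (simp add: nat_pow_pow mult.commute)
  qed
  \<comment> \<open>Summing over \<open>k\<close> first isolates the factor \<open>u [^] j\<close>:
    its coefficient vanishes by \<open>v_sum\<close> unless \<open>j = 0\<close>, where
    \<open>n\<close> copies of \<open>\<one>\<close> are added.\<close>
  have inner: "(\<Oplus>k\<in>{..<n}. x k [^] j) = (if j = 0 then [n] \<cdot> \<one> else \<zero>)" if "j < n" for j
  proof (cases "j = 0")
    case True
    then show ?thesis using add.finprod_const[of \<one> "{..<n}"] by simp
  next
    case False
    have "(\<Oplus>k\<in>{..<n}. x k [^] j) = (\<Oplus>k\<in>{..<n}. v [^] (k * j)) \<otimes> u [^] j"
      using v u by (simp add: x_pow finsum_ldistr)
    then show ?thesis using v_sum that False u by simp
  qed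
  have sum_e: "(\<Oplus>k\<in>{..<n}. e k) = \<one>"
  proof -
    have "(\<Oplus>k\<in>{..<n}. e k) = N \<otimes> (\<Oplus>k\<in>{..<n}. \<Oplus>j\<in>{..<n}. x k [^] j)"
      unfolding e_def using N S by (intro finsum_rdistr[symmetric]) auto
    also have "(\<Oplus>k\<in>{..<n}. \<Oplus>j\<in>{..<n}. x k [^] j) = (\<Oplus>j\<in>{..<n}. \<Oplus>k\<in>{..<n}. x k [^] j)"
      using x by (intro finsum_swap) auto
    \<comment> \<open>The test reads \<open>0 = j\<close> to fit
      \<open>add.finprod_singleton\<close>; the index \<open>0\<close> lies in the range because
      \<open>n > 0\<close>.\<close>
    also have "\<dots> = (\<Oplus>j\<in>{..<n}. if 0 = j then [n] \<cdot> \<one> else \<zero>)"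
      using inner by (intro finsum_cong') auto
    also have "\<dots> = [n] \<cdot> \<one>"
      using n add.finprod_singleton[of 0 "{..<n}" "\<lambda>_. [n] \<cdot> \<one>"] by simp
    finally show ?thesis using n by (simp add: N_def)
  qed
  have idem: "e k \<otimes> e k = e k" if "k < n" for k
  proof -
    have "e k = e k \<otimes> (\<Oplus>l\<in>{..<n}. e l)"
      using sum_e e by simp
    also have "\<dots> = (\<Oplus>l\<in>{..<n}. e k \<otimes> e l)"
      using e by (intro finsum_rdistr) auto
    also have "\<dots> = (\<Oplus>l\<in>{..<n}. if k = l then e k \<otimes> e l else \<zero>)"
      using e orth that by (intro finsum_cong') auto
    also have "\<dots> = e k \<otimes> e k"
      using e that by (intro add.finprod_singleton) auto
    finally show ?thesis by simp
  qed
  \<comment> \<open>Multiplying the decomposition of \<open>\<one>\<close> by \<open>u\<close> turns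
    each summand into its eigenvalue multiple.\<close>
  have "u = u \<otimes> (\<Oplus>k\<in>{..<n}. e k)"
    using sum_e u by simp
  also have "\<dots> = (\<Oplus>k\<in>{..<n}. u \<otimes> e k)"
    using u e by (intro finsum_rdistr) auto
  also have "\<dots> = (\<Oplus>k\<in>{..<n}. w [^] k \<otimes> e k)"
    by (simp only: eigen)
  finally show thesis
    using that[of e] e idem orth sum_e by blast
qed

end

theorem lemma4p1:
  fixes R :: "('a, 'm) ring_scheme"
    and n :: nat and \<omega> a b u :: 'a
  assumes "ring R"
    and "n > 0"
    and "[n] \<cdot>\<^bsub>R\<^esub> \<one>\<^bsub>R\<^esub> \<in> Units R"
    and "\<omega> \<in> Units (center_ring R)"
    and "\<omega> [^]\<^bsub>R\<^esub> n = \<one>\<^bsub>R\<^esub>"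
    and "\<And>i j :: nat. i \<le> n - 1 \<Longrightarrow> j \<le> n - 1 \<Longrightarrow> i \<noteq> j \<Longrightarrow>
           \<omega> [^]\<^bsub>R\<^esub> i \<ominus>\<^bsub>R\<^esub> \<omega> [^]\<^bsub>R\<^esub> j \<in> Units R"
    and "a \<in> carrier R" and "b \<in> carrier R"
    and "u = ring_commutator R a b"
    and "u [^]\<^bsub>R\<^esub> n = \<one>\<^bsub>R\<^esub>"
  shows "\<exists>e :: nat \<Rightarrow> 'a.
      (\<forall>k \<in> {0..n - 1}. e k \<in> carrier R) \<and>
      (\<forall>k \<in> {0..n - 1}. e k [^]\<^bsub>R\<^esub> (2::nat) = e k) \<and>
      (\<forall>k \<in> {0..n - 1}. \<forall>l \<in> {0..n - 1}. k \<noteq> l \<longrightarrow> e k \<otimes>\<^bsub>R\<^esub> e l = \<zero>\<^bsub>R\<^esub>) \<and>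
      (\<Oplus>\<^bsub>R\<^esub>k \<in> {0..n - 1}. e k) = \<one>\<^bsub>R\<^esub> \<and>
      u = (\<Oplus>\<^bsub>R\<^esub>k \<in> {0..n - 1}. \<omega> [^]\<^bsub>R\<^esub> k \<otimes>\<^bsub>R\<^esub> e k)"
proof -
  interpret ring R by fact
  have w: "\<omega> \<in> ring_center R"
    using assms(4) by (auto simp: Units_def center_ring_def)
  \<comment> \<open>With truncated subtraction this fails for \<open>n = 0\<close>, so positivity
    enters.\<close>
  have range: "{0..n - 1} = {..<n}"
    using assms(2) by auto
  obtain e :: "nat \<Rightarrow> 'a" where
    "\<And>k. e k \<in> carrier R"
    "\<And>k. k < n \<Longrightarrow> e k \<otimes>\<^bsub>R\<^esub> e k = e k"
    "\<And>k l. k < n \<Longrightarrow> l < n \<Longrightarrow> k \<noteq> l \<Longrightarrow> e k \<otimes>\<^bsub>R\<^esub> e l = \<zero>\<^bsub>R\<^esub>"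
    "(\<Oplus>\<^bsub>R\<^esub>k\<in>{..<n}. e k) = \<one>\<^bsub>R\<^esub>"
    "u = (\<Oplus>\<^bsub>R\<^esub>k\<in>{..<n}. \<omega> [^]\<^bsub>R\<^esub> k \<otimes>\<^bsub>R\<^esub> e k)"
  proof (rule root_of_unity_decomposition[of n \<omega> u])
    show "\<omega> [^]\<^bsub>R\<^esub> i \<ominus>\<^bsub>R\<^esub> \<omega> [^]\<^bsub>R\<^esub> j \<in> Units R" if "i < n" "j < n" "i \<noteq> j" for i j :: nat
      using assms(6)[of i j] that by simp
    show "u \<in> carrier R"
      using assms(7-9) by (simp add: ring_commutator_def)
  qed (use assms(2,3,5,10) w in \<open>auto simp: ring_center_def\<close>)
  then show ?thesis
    unfolding range by (intro exI[of _ e]) (auto simp: numeral_2_eq_2)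
qed

end
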